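(* Let $n\ge1$, let $M$ be a positive integer and let $\delta>0$ satisfy $\delta^{-1}=M+1$. Let $u:\{0,\delta,2\delta,\dots,1\}\times(\delta\mathbb{Z})^n\to\mathbb{R}$ be $\delta$-discrete harmonic in the strip $[0,1]\times\mathbb{R}^n$, i.e. $\Delta_{\delta,n+1}u(\delta k,\delta j)=0$ for all $k=1,\dots,M$ and $j\in\mathbb{Z}^n$. Suppose that $$|u(x,y)|=o\big(\exp(b_\delta\|y\|_1)\big),\qquad \|y\|_1\to\infty,$$ where $b_\delta>0$ is defined by $$\cosh(\delta b_\delta)=\frac{n+1}{n}-\frac1n\cos(\pi\delta),$$ and that $$\{u(0,\delta j)\}_{j\in\mathbb{Z}^n}\in l^2(\mathbb{Z}^n),\qquad \{u(1,\delta j)\}_{j\in\mathbb{Z}^n}\in l^2(\mathbb{Z}^n).$$ For $k=0,1,\dots,M$ let $$m(k)=\delta^2\sum_{j\in\mathbb{Z}^n}|u_x(\delta k,\delta j)|^2+\delta^2\sum_{l=1}^n\sum_{j\in\mathbb{Z}^n}|u_{y_l}(\delta k,\delta j)|^2 .$$ Then for $k=0,1,\dots,M$ $$m(k)\le\big(m(0)\big)^{1-\frac kM}\big(m(M)\big)^{\frac kM}.$$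
   Context: For $y\in\mathbb{R}^n$, $\|y\|_1=|y_1|+\dots+|y_n|$. Points of $(\delta\mathbb{Z})^{n+1}$ are written $(x,y)$ with $x\in\delta\mathbb{Z}$, $y\in(\delta\mathbb{Z})^n$. The $\delta$-discrete Laplacian on $(\delta\mathbb{Z})^m$ is $$\Delta_{\delta,m}u(z)=\delta^{-2}\Big(\sum_{i=1}^m\big(u(z+\delta e_i)+u(z-\delta e_i)\big)-2m\,u(z)\Big),$$ with $e_1,\dots,e_m$ the standard basis. The discrete partial derivatives are $$u_x(x,y)=\delta^{-1}\big(u(x+\delta,y)-u(x,y)\big),\qquad u_{y_l}(x,y)=\delta^{-1}\big(u(x,y+\delta e_l)-u(x,y)\big),\quad l=1,\dots,n,$$ where in the second formula $e_l$ is the $l$-th standard basis vector of $\mathbb{R}^n$. The $o(\cdot)$ condition means: for every $\varepsilon>0$ there is $R>0$ such that $|u(x,y)|\le\varepsilon\exp(b_\delta\|y\|_1)$ for all $x\in\{0,\delta,\dots,1\}$ and all $y\in(\delta\mathbb{Z})^n$ with $\|y\|_1\ge R$. *)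

theory Defs
  imports "HOL-Analysis.Analysis"
begin

text \<open>
  A function on the strip \<open>{0, \<delta>, \<dots>, 1} \<times> (\<delta>\<int>)\<^sup>n\<close> is represented by a total function
  \<open>u :: real \<times> (real ^ 'n) \<Rightarrow> real\<close>, with \<open>n = CARD('n)\<close>. Only its values at the points
  \<open>(\<delta> k, grid \<delta> j)\<close> with \<open>k \<le> M + 1\<close> are ever constrained or used.
\<close>

definition grid :: "real \<Rightarrow> int ^ 'n \<Rightarrow> real ^ 'n::finite" where
  "grid \<delta> j = (\<chi> i. \<delta> * real_of_int (j $ i))"

definition norm1 :: "real ^ 'n::finite \<Rightarrow> real" where
  "norm1 y = (\<Sum>i\<in>UNIV. \<bar>y $ i\<bar>)"

text \<open>
  On \<open>real \<times> (real ^ 'n)\<close> the set \<open>Basis\<close> is the standard basis of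
  \<open>\<real>\<^sup>n\<^sup>+\<^sup>1\<close> and \<open>DIM\<close> is \<open>n + 1\<close>.
\<close>

definition discrete_laplacian :: "real \<Rightarrow> ('a::euclidean_space \<Rightarrow> real) \<Rightarrow> 'a \<Rightarrow> real" where
  "discrete_laplacian \<delta> u z =
     ((\<Sum>e\<in>Basis. u (z + \<delta> *\<^sub>R e) + u (z - \<delta> *\<^sub>R e)) - 2 * real DIM('a) * u z) / \<delta>\<^sup>2"

definition diff_x :: "real \<Rightarrow> (real \<times> (real ^ 'n::finite) \<Rightarrow> real) \<Rightarrow> real \<Rightarrow> real ^ 'n \<Rightarrow> real" where
  "diff_x \<delta> u x y = (u (x + \<delta>, y) - u (x, y)) / \<delta>"

definition diff_y ::
    "real \<Rightarrow> (real \<times> (real ^ 'n::finite) \<Rightarrow> real) \<Rightarrow> 'n \<Rightarrow> real \<Rightarrow> real ^ 'n \<Rightarrow> real" where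
  "diff_y \<delta> u l x y = (u (x, y + \<delta> *\<^sub>R axis l 1) - u (x, y)) / \<delta>"

text \<open>
  An \<open>infsum\<close> is \<open>0\<close> when the family is not summable, so \<open>slice_energy\<close> is the intended
  quantity only together with \<open>finite_slice_energy\<close>.
\<close>

definition finite_slice_energy ::
    "real \<Rightarrow> (real \<times> (real ^ 'n::finite) \<Rightarrow> real) \<Rightarrow> nat \<Rightarrow> bool" where
  "finite_slice_energy \<delta> u k \<longleftrightarrow>
     (\<lambda>j. \<bar>diff_x \<delta> u (\<delta> * real k) (grid \<delta> j)\<bar>\<^sup>2) summable_on UNIV \<and>
     (\<forall>l. (\<lambda>j. \<bar>diff_y \<delta> u l (\<delta> * real k) (grid \<delta> j)\<bar>\<^sup>2) summable_on UNIV)"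

definition slice_energy ::
    "real \<Rightarrow> (real \<times> (real ^ 'n::finite) \<Rightarrow> real) \<Rightarrow> nat \<Rightarrow> real" where
  "slice_energy \<delta> u k =
     \<delta>\<^sup>2 * (\<Sum>\<^sub>\<infinity>j\<in>UNIV. \<bar>diff_x \<delta> u (\<delta> * real k) (grid \<delta> j)\<bar>\<^sup>2) +
     \<delta>\<^sup>2 * (\<Sum>l\<in>UNIV. \<Sum>\<^sub>\<infinity>j\<in>UNIV. \<bar>diff_y \<delta> u l (\<delta> * real k) (grid \<delta> j)\<bar>\<^sup>2)"

text \<open>
  Real power of a nonnegative base with the convention \<open>0\<^sup>0 = 1\<close>
  (whereas \<open>0 powr 0 = 0\<close>).
\<close>

definition rpow :: "real \<Rightarrow> real \<Rightarrow> real" where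
  "rpow a t = (if t = 0 then 1 else a powr t)"

end

theory Submission
  imports Defs
begin

text \<open>
  Write \<open>U k j\<close> for the value of \<open>u\<close> at \<open>(\<delta> k, \<delta> j)\<close>, and \<open>n\<close> for the dimension of the lattice.
  The proof has two halves: every layer \<open>U k\<close> lies in \<open>\<ell>\<^sup>2(\<int>\<^sup>n)\<close>, and then the gradient
  energy is log-convex in \<open>k\<close>.

  For the first half, \<open>sin (\<pi> x) \<Prod>\<^sub>l cosh (b y\<^sub>l)\<close> is discrete harmonic exactly because of the
  equation that defines \<open>b\<close>. It vanishes on the boundary of the strip and dominates the growth of
  \<open>u\<close> inside, so a comparison argument bounds \<open>u\<close> by its boundary values
  (\<open>strip_harmonic_bounded\<close>). Now \<open>u\<^sup>2\<close> is bounded and subharmonic. Its sums over the layers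
  against the weight \<open>r\<^bsup>|j|\<^esup>\<close> with \<open>r < 1\<close> satisfy
  \<open>s (k + 1) + s (k - 1) \<ge> (2 - \<kappa>) s k\<close>, where \<open>\<kappa> = 2 n (1 / r - 1)\<close> tends to \<open>0\<close> as \<open>r\<close> tends
  to \<open>1\<close>. This bounds them by a constant times the squared \<open>\<ell>\<^sup>2\<close> norms of the boundary data,
  uniformly in \<open>r\<close> near \<open>1\<close>, and the limit \<open>r \<rightarrow> 1\<close> gives the claim
  (\<open>strip_harmonic_square_summable\<close>).

  For the second half, let \<open>E(k, l)\<close> be the \<open>\<ell>\<^sup>2\<close> inner product of the discrete gradients on the
  layers \<open>k\<close> and \<open>l\<close>, so that the energy of layer \<open>k\<close> is \<open>E(k, k)\<close>. Self-adjointness of the lattice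
  Laplacian and the three-term recurrence between layers give \<open>E(k - 1, k + 1) = E(k, k)\<close>
  (\<open>energy_form_shift\<close>). Hence, by Cauchy--Schwarz, \<open>m(k)\<^sup>2 \<le> m(k - 1) m(k + 1)\<close> for
  \<open>1 \<le> k < M\<close>, and a log-convex sequence lies below the geometric interpolation of its end values
  (\<open>log_convex_interpolation\<close>).
\<close>

section \<open>Functions on the integer lattice\<close>

lemma axis_minus_one: "j - axis l (1::int) = j + axis l (- 1)" for j :: "int ^ 'n"
  by (simp add: vec_eq_iff axis_def)

lemma finite_lattice_box: "finite {j :: int ^ 'n::finite. \<forall>i. \<bar>j $ i\<bar> \<le> N}"
proof (rule finite_subset)
  show "{j :: int ^ 'n. \<forall>i. \<bar>j $ i\<bar> \<le> N} \<subseteq> vec_lambda ` (PiE UNIV (\<lambda>_. {-N..N}))"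
  proof
    fix j :: "int ^ 'n" assume "j \<in> {j. \<forall>i. \<bar>j $ i\<bar> \<le> N}"
    then have "vec_nth j \<in> PiE UNIV (\<lambda>_. {-N..N})"
      by (auto simp: abs_le_iff minus_le_iff)
    then show "j \<in> vec_lambda ` (PiE UNIV (\<lambda>_. {-N..N}))"
      by (intro image_eqI[of _ _ "vec_nth j"]) auto
  qed
  show "finite (vec_lambda ` (PiE (UNIV :: 'n set) (\<lambda>_. {-N..N})))"
    by (intro finite_imageI finite_PiE) auto
qed

lemma prod_coords_add_axis:
  fixes f :: "int \<Rightarrow> 'b::comm_monoid_mult" and j :: "int ^ 'n::finite"
  shows "(\<Prod>i\<in>UNIV. f ((j + axis l c) $ i)) = f (j $ l + c) * (\<Prod>i\<in>UNIV - {l}. f (j $ i))"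
  by (subst prod.remove[of _ l]) (auto simp: axis_def intro!: prod.cong)

text \<open>The sum of \<open>f\<close> over the \<open>2 n\<close> nearest neighbours of \<open>j\<close> in \<open>\<int>\<^sup>n\<close>.\<close>

definition nbr_sum :: "(int ^ 'n::finite \<Rightarrow> real) \<Rightarrow> int ^ 'n \<Rightarrow> real" where
  "nbr_sum f j = (\<Sum>l\<in>UNIV. f (j + axis l 1) + f (j - axis l 1))"

lemma nbr_sum_le:
  fixes f :: "int ^ 'n::finite \<Rightarrow> real"
  assumes "\<And>i. f i \<le> m"
  shows "nbr_sum f j \<le> 2 * real CARD('n) * m"
proof -
  have "nbr_sum f j \<le> real (card (UNIV :: 'n set)) * (2 * m)"
    unfolding nbr_sum_def
  proof (rule sum_bounded_above)
    fix l :: 'n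
    show "f (j + axis l 1) + f (j - axis l 1) \<le> 2 * m"
      using assms[of "j + axis l 1"] assms[of "j - axis l 1"] by simp
  qed
  then show ?thesis by simp
qed

lemma nbr_sum_diff_scale: "nbr_sum (\<lambda>i. f i - c * g i) j = nbr_sum f j - c * nbr_sum g j"
  by (simp add: nbr_sum_def sum_subtractf[symmetric] sum_distrib_left algebra_simps)

text \<open>
  Discrete harmonicity in the strip with \<open>M\<close> interior layers: the slice \<open>U k\<close> stands for the
  values on the layer \<open>x = \<delta> k\<close>, and the mesh size has been scaled away.
\<close>

definition strip_harmonic :: "nat \<Rightarrow> (nat \<Rightarrow> int ^ 'n::finite \<Rightarrow> real) \<Rightarrow> bool" where
  "strip_harmonic M U \<longleftrightarrow> (\<forall>k\<in>{1..M}. \<forall>j.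
     U (k + 1) j + U (k - 1) j + nbr_sum (U k) j = 2 * (real CARD('n) + 1) * U k j)"

lemma sum_Basis_prod:
  fixes f :: "'a::euclidean_space \<times> 'b::euclidean_space \<Rightarrow> real"
  shows "sum f Basis = (\<Sum>i\<in>Basis. f (i, 0)) + (\<Sum>i\<in>Basis. f (0, i))"
proof -
  have "inj_on (\<lambda>u. (u::'a, 0::'b)) Basis" "inj_on (\<lambda>u. (0::'a, u::'b)) Basis"
    by (auto intro!: inj_onI)
  then show ?thesis
    unfolding Basis_prod_def
    by (subst sum.union_disjoint) (auto simp: sum.reindex)
qed

lemma sum_Basis_cart:
  fixes f :: "real ^ 'n::finite \<Rightarrow> real"
  shows "sum f Basis = (\<Sum>l\<in>UNIV. f (axis l 1))"
proof -
  have B: "(Basis :: (real ^ 'n) set) = (\<lambda>l. axis l 1) ` UNIV"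
    by (auto simp: Basis_vec_def)
  have inj: "inj (\<lambda>l. axis l 1 :: real ^ 'n)"
    by (auto simp: inj_on_def axis_eq_axis)
  show ?thesis unfolding B by (subst sum.reindex[OF inj]) simp
qed

lemma grid_add_axis: "grid \<delta> j + \<delta> *\<^sub>R axis l 1 = grid \<delta> (j + axis l 1)"
  by (simp add: grid_def vec_eq_iff axis_def algebra_simps)

lemma grid_diff_axis: "grid \<delta> j - \<delta> *\<^sub>R axis l 1 = grid \<delta> (j - axis l 1)"
  by (simp add: grid_def vec_eq_iff axis_def algebra_simps)

lemma norm1_grid: "\<delta> > 0 \<Longrightarrow> norm1 (grid \<delta> j) = \<delta> * (\<Sum>i\<in>UNIV. \<bar>real_of_int (j $ i)\<bar>)"
  by (simp add: norm1_def grid_def abs_mult sum_distrib_left)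

lemma finite_norm1_grid_less:
  assumes "\<delta> > 0"
  shows "finite {j :: int ^ 'n::finite. norm1 (grid \<delta> j) < R}"
proof (rule finite_subset[OF _ finite_lattice_box[of "\<lceil>R / \<delta>\<rceil>"]], clarify)
  fix j :: "int ^ 'n" and i
  assume "norm1 (grid \<delta> j) < R"
  then have "(\<Sum>i\<in>UNIV. \<bar>real_of_int (j $ i)\<bar>) < R / \<delta>"
    using assms by (simp add: norm1_grid field_simps)
  moreover have "\<bar>real_of_int (j $ i)\<bar> \<le> (\<Sum>i\<in>UNIV. \<bar>real_of_int (j $ i)\<bar>)"
    by (rule member_le_sum) auto
  ultimately have "real_of_int \<bar>j $ i\<bar> \<le> R / \<delta>" by simp
  then show "\<bar>j $ i\<bar> \<le> \<lceil>R / \<delta>\<rceil>" by linarith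
qed

lemma discrete_laplacian_zero_imp_strip_harmonic:
  fixes u :: "real \<times> (real ^ 'n::finite) \<Rightarrow> real"
  assumes "\<delta> > 0"
    and harm: "\<And>k (j :: int ^ 'n). k \<in> {1..M} \<Longrightarrow>
           discrete_laplacian \<delta> u (\<delta> * real k, grid \<delta> j) = 0"
  shows "strip_harmonic M (\<lambda>k j. u (\<delta> * real k, grid \<delta> j))"
  unfolding strip_harmonic_def
proof (intro ballI allI)
  fix k and j :: "int ^ 'n" assume k: "k \<in> {1..M}"
  have "\<delta> * real k + \<delta> = \<delta> * real (k + 1)" "\<delta> * real k - \<delta> = \<delta> * real (k - 1)"
    using k by (auto simp: algebra_simps of_nat_diff)
  then show "u (\<delta> * real (k + 1), grid \<delta> j) + u (\<delta> * real (k - 1), grid \<delta> j) +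
      nbr_sum (\<lambda>j. u (\<delta> * real k, grid \<delta> j)) j =
      2 * (real CARD('n) + 1) * u (\<delta> * real k, grid \<delta> j)"
    using harm[OF k, of j] assms(1)
    by (simp add: discrete_laplacian_def sum_Basis_prod sum_Basis_cart
        grid_add_axis grid_diff_axis nbr_sum_def algebra_simps)
qed

section \<open>The maximum principle under exponential growth\<close>

text \<open>
  A subharmonic \<open>v\<close> that is nonpositive on the two boundary layers, and that outside a finite set
  is dominated by every positive multiple of a superharmonic \<open>h\<close>, is nonpositive: for each
  \<open>\<epsilon>\<close> the maximum principle on a finite set gives \<open>v \<le> \<epsilon> h\<close>.
\<close>

lemma strip_comparison:
  fixes v h :: "nat \<Rightarrow> int ^ 'n::finite \<Rightarrow> real"
  assumes v: "\<And>k j. k \<in> {1..M} \<Longrightarrow>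
      2 * (real CARD('n) + 1) * v k j \<le> v (k + 1) j + v (k - 1) j + nbr_sum (v k) j"
    and h: "\<And>k j. k \<in> {1..M} \<Longrightarrow>
      h (k + 1) j + h (k - 1) j + nbr_sum (h k) j \<le> 2 * (real CARD('n) + 1) * h k j"
    and v_bd: "\<And>j. v 0 j \<le> 0" "\<And>j. v (M + 1) j \<le> 0"
    and h_bd: "\<And>j. h 0 j \<ge> 0" "\<And>j. h (M + 1) j \<ge> 0"
    and fin: "\<And>\<epsilon>. \<epsilon> > 0 \<Longrightarrow> finite {(k, j). k \<le> M + 1 \<and> v k j > \<epsilon> * h k j}"
    and "k \<le> M + 1"
  shows "v k j \<le> 0"
proof -
  have le: "v k j \<le> \<epsilon> * h k j" if "\<epsilon> > 0" "k \<le> M + 1" for \<epsilon> k j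
  proof (rule ccontr)
    assume "\<not> v k j \<le> \<epsilon> * h k j"
    define w where "w k j = v k j - \<epsilon> * h k j" for k j
    have w_sub: "2 * (real CARD('n) + 1) * w k j \<le> w (k + 1) j + w (k - 1) j + nbr_sum (w k) j"
      if "k \<in> {1..M}" for k j
    proof -
      have "\<epsilon> * (h (k + 1) j + h (k - 1) j + nbr_sum (h k) j) \<le>
          \<epsilon> * (2 * (real CARD('n) + 1) * h k j)"
        using h[OF that] \<open>\<epsilon> > 0\<close> by (intro mult_left_mono) auto
      with v[OF that, of j] show ?thesis
        unfolding w_def nbr_sum_diff_scale by (simp add: algebra_simps)
    qed
    have w_bd: "w 0 j \<le> 0" "w (M + 1) j \<le> 0" for j
      using v_bd[of j] h_bd[of j] mult_nonneg_nonneg[of \<epsilon> "h 0 j"]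
        mult_nonneg_nonneg[of \<epsilon> "h (M + 1) j"] \<open>\<epsilon> > 0\<close> unfolding w_def
      by linarith+
    define S where "S = {(k, j). k \<le> M + 1 \<and> w k j > 0}"
    define W where "W = (\<lambda>(k, j). w k j)"
    have "finite S" using fin[OF \<open>\<epsilon> > 0\<close>] unfolding S_def w_def by simp
    moreover have "(k, j) \<in> S"
      using \<open>\<not> v k j \<le> \<epsilon> * h k j\<close> \<open>k \<le> M + 1\<close> by (simp add: S_def w_def)
    ultimately have fS: "finite (W ` S)" "W ` S \<noteq> {}" by auto
    define m where "m = Max (W ` S)"
    have m_in: "m \<in> W ` S" unfolding m_def using fS by (rule Max_in)
    then have "m > 0" by (auto simp: S_def W_def)
    have w_le: "w k j \<le> m" if "k \<le> M + 1" for k j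
    proof (cases "w k j > 0")
      case True
      then have "w k j \<in> W ` S"
        using that by (intro image_eqI[of _ _ "(k, j)"]) (auto simp: S_def W_def)
      then show ?thesis unfolding m_def using fS by (intro Max_ge)
    qed (use \<open>m > 0\<close> in linarith)
    \<comment> \<open>Among the maximum points, one on the last possible layer leads to a contradiction.\<close>
    define T where "T = {k. k \<le> M + 1 \<and> (\<exists>j. w k j = m)}"
    have fT: "finite T" by (simp add: T_def)
    have neT: "T \<noteq> {}" using m_in by (auto simp: T_def S_def W_def)
    define K where "K = Max T"
    have "K \<in> T" unfolding K_def using fT neT by (rule Max_in)
    then obtain i where i: "w K i = m" "K \<le> M + 1" by (auto simp: T_def)
    have "K \<noteq> 0" "K \<noteq> M + 1" using w_bd[of i] i(1) \<open>m > 0\<close> by (metis not_le)+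
    then have K: "K \<in> {1..M}" using i by auto
    have "2 * (real CARD('n) + 1) * m \<le> w (K + 1) i + w (K - 1) i + nbr_sum (w K) i"
      using w_sub[OF K, of i] i by simp
    moreover have "nbr_sum (w K) i \<le> 2 * real CARD('n) * m"
      using w_le K by (intro nbr_sum_le) auto
    moreover have "w (K - 1) i \<le> m" "w (K + 1) i \<le> m" using w_le K by auto
    ultimately have "w (K + 1) i = m" by (simp add: algebra_simps)
    then have "K + 1 \<in> T" using K by (auto simp: T_def)
    then have "K + 1 \<le> K" unfolding K_def using fT by (rule Max_ge[rotated])
    then show False by simp
  qed
  show ?thesis
  proof (rule ccontr)
    assume "\<not> v k j \<le> 0"
    then have pos: "v k j > 0" by simp
    then have "h k j > 0" using le[of 1 k j] \<open>k \<le> M + 1\<close> by simp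
    then have "v k j \<le> v k j / (2 * h k j) * h k j"
      using le[of "v k j / (2 * h k j)" k j] \<open>k \<le> M + 1\<close> pos by simp
    then show False using pos \<open>h k j > 0\<close> by simp
  qed
qed

text \<open>
  The barrier: \<open>sin (\<pi> x)\<close> is an eigenfunction of the second difference in \<open>x\<close>, each
  \<open>cosh (b y\<^sub>l)\<close> is one in \<open>y\<^sub>l\<close>, and the equation for \<open>b\<close> makes the eigenvalues cancel.
  Here \<open>c\<close> is \<open>\<delta> b\<close>.
\<close>

definition barrier :: "real \<Rightarrow> real \<Rightarrow> nat \<Rightarrow> int ^ 'n::finite \<Rightarrow> real" where
  "barrier \<delta> c k j = sin (pi * (\<delta> * real k)) * (\<Prod>i\<in>UNIV. cosh (c * real_of_int (j $ i)))"

lemma barrier_harmonic: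
  assumes c: "cosh c = (real CARD('n) + 1) / real CARD('n) - 1 / real CARD('n) * cos (pi * \<delta>)"
  shows "strip_harmonic M (barrier \<delta> c :: nat \<Rightarrow> int ^ 'n::finite \<Rightarrow> real)"
  unfolding strip_harmonic_def
proof (intro ballI allI)
  fix k and j :: "int ^ 'n" assume k: "k \<in> {1..M}"
  define P where "P = (\<Prod>i\<in>UNIV. cosh (c * real_of_int (j $ i)))"
  define s where "s = sin (pi * (\<delta> * real k))"
  have n: "real CARD('n) * cosh c = real CARD('n) + 1 - cos (pi * \<delta>)"
    unfolding c by (simp add: field_simps)
  have x: "barrier \<delta> c (k + 1) j + barrier \<delta> c (k - 1) j = 2 * cos (pi * \<delta>) * (s * P)"
  proof -
    have eqs: "pi * (\<delta> * real (k + 1)) = pi * (\<delta> * real k) + pi * \<delta>"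
      "pi * (\<delta> * real (k - 1)) = pi * (\<delta> * real k) - pi * \<delta>"
      using k by (auto simp: algebra_simps of_nat_diff)
    show ?thesis
      unfolding barrier_def s_def P_def eqs sin_add sin_diff by (simp add: algebra_simps)
  qed
  have y: "barrier \<delta> c k (j + axis l 1) + barrier \<delta> c k (j - axis l 1) = 2 * cosh c * (s * P)"
    for l
  proof -
    let ?Q = "\<Prod>i\<in>UNIV - {l}. cosh (c * real_of_int (j $ i))"
    have "barrier \<delta> c k (j + axis l a) = s * (cosh (c * real_of_int (j $ l + a)) * ?Q)" for a
      using prod_coords_add_axis[of "\<lambda>m. cosh (c * real_of_int m)" j l a]
      by (simp add: barrier_def s_def)
    moreover have "P = cosh (c * real_of_int (j $ l)) * ?Q"
      unfolding P_def by (subst prod.remove[of _ l]) auto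
    ultimately show ?thesis
      by (simp add: axis_minus_one cosh_add cosh_diff distrib_left right_diff_distrib)
        (simp add: algebra_simps)
  qed
  have "nbr_sum (barrier \<delta> c k) j = 2 * (real CARD('n) * cosh c) * (s * P)"
    by (simp add: nbr_sum_def y)
  then show "barrier \<delta> c (k + 1) j + barrier \<delta> c (k - 1) j + nbr_sum (barrier \<delta> c k) j =
      2 * (real CARD('n) + 1) * barrier \<delta> c k j"
    unfolding x n by (simp add: barrier_def s_def P_def algebra_simps)
qed

lemma prod_cosh_ge:
  fixes j :: "int ^ 'n::finite"
  assumes "c > 0"
  shows "exp (c * (\<Sum>i\<in>UNIV. \<bar>real_of_int (j $ i)\<bar>)) / 2 ^ CARD('n) \<le>
    (\<Prod>i\<in>UNIV. cosh (c * real_of_int (j $ i)))"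
proof -
  have "exp (c * (\<Sum>i\<in>UNIV. \<bar>real_of_int (j $ i)\<bar>)) / 2 ^ CARD('n) =
      (\<Prod>i\<in>(UNIV :: 'n set). exp (c * \<bar>real_of_int (j $ i)\<bar>) / 2)"
    by (simp add: sum_distrib_left exp_sum prod_dividef)
  also have "\<dots> \<le> (\<Prod>i\<in>UNIV. cosh (c * real_of_int (j $ i)))"
  proof (rule prod_mono, intro conjI)
    fix i
    have "exp (c * \<bar>real_of_int (j $ i)\<bar>) / 2 \<le> cosh (c * \<bar>real_of_int (j $ i)\<bar>)"
      by (simp add: cosh_def)
    also have "\<dots> = cosh (c * real_of_int (j $ i))"
      using assms by (simp add: abs_if)
    finally show "exp (c * \<bar>real_of_int (j $ i)\<bar>) / 2 \<le> cosh (c * real_of_int (j $ i))" .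
  qed simp
  finally show ?thesis .
qed

text \<open>
  The barrier vanishes on the boundary layers and is at least a constant times
  \<open>exp (b \<parallel>y\<parallel>\<^sub>1)\<close> on the interior ones, so the growth condition lets the comparison principle
  reduce the bound to the boundary.
\<close>

lemma strip_harmonic_bounded:
  fixes U :: "nat \<Rightarrow> int ^ 'n::finite \<Rightarrow> real"
  assumes "\<delta> > 0" and M: "1 / \<delta> = real M + 1" and "b > 0"
    and U: "strip_harmonic M U"
    and b: "cosh (\<delta> * b) =
           (real CARD('n) + 1) / real CARD('n) - 1 / real CARD('n) * cos (pi * \<delta>)"
    and growth: "\<And>\<epsilon>. \<epsilon> > 0 \<Longrightarrow> \<exists>R>0. \<forall>k\<le>M + 1. \<forall>j :: int ^ 'n.
           norm1 (grid \<delta> j) \<ge> R \<longrightarrow> \<bar>U k j\<bar> \<le> \<epsilon> * exp (b * norm1 (grid \<delta> j))"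
    and bd: "\<And>j. \<bar>U 0 j\<bar> \<le> C" "\<And>j. \<bar>U (M + 1) j\<bar> \<le> C"
    and "k \<le> M + 1"
  shows "\<bar>U k j\<bar> \<le> C"
proof -
  define h :: "nat \<Rightarrow> int ^ 'n \<Rightarrow> real" where "h = barrier \<delta> (\<delta> * b)"
  have h: "strip_harmonic M h" unfolding h_def using b by (rule barrier_harmonic)
  have "C \<ge> 0" using bd(1)[of 0] by simp
  have \<delta>M: "\<delta> * real (M + 1) = 1" using M \<open>\<delta> > 0\<close> by (simp add: field_simps)
  have h_bd: "h 0 j = 0" "h (M + 1) j = 0" for j
    unfolding h_def barrier_def \<delta>M by simp_all
  have sin_pos: "sin (pi * (\<delta> * real k)) > 0" if "k \<in> {1..M}" for k
  proof (rule sin_gt_zero)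
    have "\<delta> * real k < \<delta> * real (M + 1)"
      using that \<open>\<delta> > 0\<close> by (intro mult_strict_left_mono) auto
    then show "pi * (\<delta> * real k) < pi" by (simp only: \<delta>M) simp
    show "0 < pi * (\<delta> * real k)" using that \<open>\<delta> > 0\<close> by simp
  qed
  define s where "s = Min (insert 1 ((\<lambda>k. sin (pi * (\<delta> * real k))) ` {1..M}))"
  have s: "s > 0" unfolding s_def using sin_pos by (subst Min_gr_iff) auto
  have s_le: "s \<le> sin (pi * (\<delta> * real k))" if "k \<in> {1..M}" for k
    unfolding s_def using that by (intro Min_le) auto
  have h_ge: "s / 2 ^ CARD('n) * exp (b * norm1 (grid \<delta> j)) \<le> h k j" if "k \<in> {1..M}" for k j
  proof -
    have "s * (exp (\<delta> * b * (\<Sum>i\<in>UNIV. \<bar>real_of_int (j $ i)\<bar>)) / 2 ^ CARD('n)) \<le> h k j"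
      unfolding h_def barrier_def
      using s s_le[OF that] sin_pos[OF that] \<open>\<delta> > 0\<close> \<open>b > 0\<close>
      by (intro mult_mono prod_cosh_ge) auto
    then show ?thesis using \<open>\<delta> > 0\<close> by (simp add: norm1_grid mult_ac)
  qed
  have main: "\<sigma> * U k j - C \<le> 0" if \<sigma>: "\<sigma> = 1 \<or> \<sigma> = -1" for \<sigma> :: real
  proof -
    have \<sigma>_le: "\<sigma> * U k j \<le> \<bar>U k j\<bar>" for k j using \<sigma> by auto
    show ?thesis
    proof (rule strip_comparison[where h = h and v = "\<lambda>k j. \<sigma> * U k j - C"])
      fix k and j :: "int ^ 'n" assume k: "k \<in> {1..M}"
      have "nbr_sum (\<lambda>j. \<sigma> * U k j - C) j = \<sigma> * nbr_sum (U k) j - 2 * real CARD('n) * C"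
        by (simp add: nbr_sum_def sum_distrib_left sum_subtractf sum.distrib algebra_simps)
      then have "(\<sigma> * U (k + 1) j - C) + (\<sigma> * U (k - 1) j - C) +
          nbr_sum (\<lambda>j. \<sigma> * U k j - C) j =
          \<sigma> * (U (k + 1) j + U (k - 1) j + nbr_sum (U k) j) - 2 * (real CARD('n) + 1) * C"
        by (simp add: algebra_simps)
      also have "\<dots> = 2 * (real CARD('n) + 1) * (\<sigma> * U k j - C)"
        using U k by (simp add: strip_harmonic_def algebra_simps)
      finally show "2 * (real CARD('n) + 1) * (\<sigma> * U k j - C) \<le>
          (\<sigma> * U (k + 1) j - C) + (\<sigma> * U (k - 1) j - C) + nbr_sum (\<lambda>j. \<sigma> * U k j - C) j"
        by simp
      show "h (k + 1) j + h (k - 1) j + nbr_sum (h k) j \<le> 2 * (real CARD('n) + 1) * h k j"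
        using h k by (simp add: strip_harmonic_def)
    next
      fix j
      show "\<sigma> * U 0 j - C \<le> 0" "\<sigma> * U (M + 1) j - C \<le> 0"
        using \<sigma>_le[of 0 j] \<sigma>_le[of "M + 1" j] bd[of j] by linarith+
      show "h 0 j \<ge> 0" "h (M + 1) j \<ge> 0" by (simp_all only: h_bd order_refl)
    next
      fix \<epsilon> :: real assume "\<epsilon> > 0"
      then obtain R where R: "\<And>k j. k \<le> M + 1 \<Longrightarrow> norm1 (grid \<delta> j) \<ge> R \<Longrightarrow>
          \<bar>U k j\<bar> \<le> \<epsilon> * (s / 2 ^ CARD('n)) * exp (b * norm1 (grid \<delta> j))"
        using growth[of "\<epsilon> * (s / 2 ^ CARD('n))"] s by auto
      show "finite {(k, j). k \<le> M + 1 \<and> \<sigma> * U k j - C > \<epsilon> * h k j}"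
      proof (rule finite_subset)
        show "finite ({..M + 1} \<times> {j :: int ^ 'n. norm1 (grid \<delta> j) < R})"
          using finite_norm1_grid_less[OF \<open>\<delta> > 0\<close>] by blast
        have "\<sigma> * U k j - C \<le> \<epsilon> * h k j" if "k \<le> M + 1" "norm1 (grid \<delta> j) \<ge> R" for k j
        proof (cases "k \<in> {1..M}")
          case True
          have "\<epsilon> * (s / 2 ^ CARD('n) * exp (b * norm1 (grid \<delta> j))) \<le> \<epsilon> * h k j"
            using h_ge[OF True] \<open>\<epsilon> > 0\<close> by (intro mult_left_mono) auto
          then show ?thesis using R[OF that] \<sigma>_le[of k j] \<open>C \<ge> 0\<close> by (simp add: mult_ac)
        next
          case False
          then have "k = 0 \<or> k = M + 1" using that(1) by auto
          then show ?thesis using h_bd[of j] bd[of j] \<sigma>_le[of k j] by (elim disjE) simp_all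
        qed
        then show "{(k, j). k \<le> M + 1 \<and> \<sigma> * U k j - C > \<epsilon> * h k j} \<subseteq>
            {..M + 1} \<times> {j. norm1 (grid \<delta> j) < R}"
          by (force simp: not_less[symmetric])
      qed
    qed (rule \<open>k \<le> M + 1\<close>)
  qed
  show ?thesis using main[of 1] main[of "-1"] by auto
qed

section \<open>Square summability of the interior layers\<close>

lemma has_sum_finite_sum:
  fixes f :: "'i \<Rightarrow> 'a \<Rightarrow> 'b::{topological_comm_monoid_add}"
  assumes "finite I" "\<And>i. i \<in> I \<Longrightarrow> (f i has_sum S i) A"
  shows "((\<lambda>x. \<Sum>i\<in>I. f i x) has_sum (\<Sum>i\<in>I. S i)) A"
  using assms by (induction I rule: finite_induct) (auto intro: has_sum_add)

lemma has_sum_translate: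
  fixes f :: "'a::ab_group_add \<Rightarrow> 'b::{comm_monoid_add, topological_space}"
  shows "((\<lambda>j. f (j + a)) has_sum S) UNIV \<longleftrightarrow> (f has_sum S) UNIV"
  by (rule has_sum_reindex_bij_witness[where i = "\<lambda>j. j - a" and j = "\<lambda>j. j + a"]) auto

text \<open>The weight \<open>r\<^bsup>|j|\<^esup>\<close>, where \<open>|j|\<close> is the \<open>\<ell>\<^sup>1\<close> norm of \<open>j\<close>.\<close>

definition weight :: "real \<Rightarrow> int ^ 'n::finite \<Rightarrow> real" where
  "weight r j = (\<Prod>i\<in>UNIV. r ^ nat \<bar>j $ i\<bar>)"

lemma weight_nonneg: "r \<ge> 0 \<Longrightarrow> weight r j \<ge> 0"
  by (simp add: weight_def prod_nonneg)

lemma weight_le_1: "0 \<le> r \<Longrightarrow> r \<le> 1 \<Longrightarrow> weight r j \<le> 1"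
  unfolding weight_def by (rule prod_le_1) (simp add: power_le_one)

lemma weight_add_axis_le:
  assumes r: "0 < r" "r < 1" and a: "\<bar>a\<bar> \<le> 1"
  shows "weight r (j + axis l a) \<le> weight r j / r"
proof -
  let ?Q = "\<Prod>i\<in>UNIV - {l}. r ^ nat \<bar>j $ i\<bar>"
  have "r ^ Suc (nat \<bar>j $ l + a\<bar>) \<le> r ^ nat \<bar>j $ l\<bar>"
    using r a by (intro power_decreasing) auto
  then have "r ^ nat \<bar>j $ l + a\<bar> \<le> r ^ nat \<bar>j $ l\<bar> / r"
    using r by (simp add: field_simps)
  then have "r ^ nat \<bar>j $ l + a\<bar> * ?Q \<le> r ^ nat \<bar>j $ l\<bar> / r * ?Q"
    using r by (intro mult_right_mono prod_nonneg) auto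
  moreover have "weight r (j + axis l a) = r ^ nat \<bar>j $ l + a\<bar> * ?Q"
    unfolding weight_def by (rule prod_coords_add_axis)
  moreover have "weight r j = r ^ nat \<bar>j $ l\<bar> * ?Q"
    unfolding weight_def by (subst prod.remove[of _ l]) auto
  ultimately show ?thesis by simp
qed

lemma summable_power_abs_int:
  assumes "0 \<le> r" "r < (1::real)"
  shows "(\<lambda>m::int. r ^ nat \<bar>m\<bar>) summable_on UNIV"
proof -
  have geo: "(\<lambda>n::nat. r ^ n) summable_on UNIV"
    using assms by (intro summable_nonneg_imp_summable_on) (auto simp: summable_geometric)
  have "(\<lambda>m::int. r ^ nat \<bar>m\<bar>) summable_on range int"
    "(\<lambda>m::int. r ^ nat \<bar>m\<bar>) summable_on range (\<lambda>n. - int n)"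
    using geo by (subst summable_on_reindex; simp add: inj_on_def o_def)+
  then have "(\<lambda>m::int. r ^ nat \<bar>m\<bar>) summable_on (range int \<union> range (\<lambda>n. - int n))"
    by (rule summable_on_union)
  moreover have "range int \<union> range (\<lambda>n. - int n) = UNIV"
  proof -
    have "m \<in> range int \<union> range (\<lambda>n. - int n)" for m
      by (cases m rule: int_cases2) auto
    then show ?thesis by blast
  qed
  ultimately show ?thesis by simp
qed

lemma summable_weight:
  assumes r: "0 \<le> r" "r < 1"
  shows "(weight r :: int ^ 'n::finite \<Rightarrow> real) summable_on UNIV"
proof (rule nonneg_bdd_above_summable_on)
  let ?S = "infsum (\<lambda>m::int. r ^ nat \<bar>m\<bar>) UNIV"
  have "sum (weight r) F \<le> ?S ^ CARD('n)" if "finite F" for F :: "(int ^ 'n) set"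
  proof -
    define B where "B = (\<lambda>i. (\<lambda>j. j $ i) ` F)"
    have fB: "finite (B i)" for i using that by (simp add: B_def)
    have "sum (weight r) F = sum (\<lambda>g. \<Prod>i\<in>UNIV. r ^ nat \<bar>g i\<bar>) (vec_nth ` F)"
      by (subst sum.reindex) (auto simp: weight_def inj_on_def vec_eq_iff)
    also have "\<dots> \<le> sum (\<lambda>g. \<Prod>i\<in>UNIV. r ^ nat \<bar>g i\<bar>) (PiE UNIV B)"
      using fB r by (intro sum_mono2 finite_PiE prod_nonneg) (auto simp: B_def)
    also have "\<dots> = (\<Prod>i\<in>(UNIV :: 'n set). \<Sum>m\<in>B i. r ^ nat \<bar>m\<bar>)"
      using fB by (subst prod_sum_PiE) auto
    also have "\<dots> \<le> (\<Prod>i\<in>(UNIV :: 'n set). ?S)"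
      using fB r summable_power_abs_int[OF r]
      by (intro prod_mono conjI sum_nonneg finite_sum_le_infsum) auto
    finally show ?thesis by simp
  qed
  then show "bdd_above (sum (weight r) ` {F :: (int ^ 'n) set. F \<subseteq> UNIV \<and> finite F})"
    by (intro bdd_aboveI2[where M = "?S ^ CARD('n)"]) auto
qed (use r in \<open>simp add: weight_nonneg\<close>)

text \<open>Here the sum of \<open>(U z - U k j)\<^sup>2\<close> over the \<open>2 n + 2\<close> neighbours \<open>z\<close> is expanded.\<close>

lemma strip_harmonic_square_subharmonic:
  fixes U :: "nat \<Rightarrow> int ^ 'n::finite \<Rightarrow> real"
  assumes "strip_harmonic M U" "k \<in> {1..M}"
  shows "2 * (real CARD('n) + 1) * (U k j)\<^sup>2 \<le>
    (U (k + 1) j)\<^sup>2 + (U (k - 1) j)\<^sup>2 + nbr_sum (\<lambda>j. (U k j)\<^sup>2) j"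
proof -
  let ?c = "U k j"
  have "0 \<le> (U (k + 1) j - ?c)\<^sup>2 + (U (k - 1) j - ?c)\<^sup>2 +
      (\<Sum>l\<in>UNIV. (U k (j + axis l 1) - ?c)\<^sup>2 + (U k (j - axis l 1) - ?c)\<^sup>2)"
    by (intro add_nonneg_nonneg sum_nonneg) auto
  also have "(\<Sum>l\<in>UNIV. (U k (j + axis l 1) - ?c)\<^sup>2 + (U k (j - axis l 1) - ?c)\<^sup>2) =
      nbr_sum (\<lambda>j. (U k j)\<^sup>2) j - 2 * ?c * nbr_sum (U k) j + 2 * real CARD('n) * ?c\<^sup>2"
  proof -
    have "(U k (j + axis l 1) - ?c)\<^sup>2 + (U k (j - axis l 1) - ?c)\<^sup>2 =
        ((U k (j + axis l 1))\<^sup>2 + (U k (j - axis l 1))\<^sup>2) -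
        2 * ?c * (U k (j + axis l 1) + U k (j - axis l 1)) + 2 * ?c\<^sup>2" for l
      by (simp add: power2_eq_square algebra_simps)
    then show ?thesis
      by (simp add: nbr_sum_def sum.distrib sum_subtractf sum_distrib_left[symmetric])
  qed
  also have "nbr_sum (U k) j = 2 * (real CARD('n) + 1) * ?c - U (k + 1) j - U (k - 1) j"
    using assms by (simp add: strip_harmonic_def algebra_simps)
  finally show ?thesis by (simp add: power2_eq_square algebra_simps)
qed

lemma has_sum_weight_mult:
  assumes r: "0 \<le> r" "r < 1" and q: "\<And>j. 0 \<le> q j" "\<And>j. q j \<le> C"
  shows "((\<lambda>j. weight r j * q j) has_sum (\<Sum>\<^sub>\<infinity>j. weight r j * q j)) UNIV"
proof -
  have "(\<lambda>j. weight r j * q j) summable_on UNIV"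
    using r q
    by (intro summable_on_comparison_test[OF summable_on_cmult_left[OF summable_weight[OF r], of C]])
      (auto intro!: mult_left_mono mult_nonneg_nonneg weight_nonneg)
  then show ?thesis by simp
qed

text \<open>
  Summing a subharmonic inequality over a layer against the weight turns it into an inequality in
  \<open>k\<close> alone. Since a unit translation changes the weight by a factor of at most \<open>1 / r\<close>, the
  \<open>2 n\<close> lateral neighbours contribute at most \<open>2 n / r\<close> times the sum on the same layer.
\<close>

lemma weighted_sum_subharmonic:
  fixes q :: "nat \<Rightarrow> int ^ 'n::finite \<Rightarrow> real"
  assumes r: "0 < r" "r < 1"
    and q: "\<And>k j. k \<le> M + 1 \<Longrightarrow> 0 \<le> q k j" "\<And>k j. k \<le> M + 1 \<Longrightarrow> q k j \<le> C"
    and sub: "\<And>j. 2 * (real CARD('n) + 1) * q k j \<le> q (k + 1) j + q (k - 1) j + nbr_sum (q k) j"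
    and k: "k \<in> {1..M}"
  defines "s \<equiv> \<lambda>k. \<Sum>\<^sub>\<infinity>j. weight r j * q k j"
  shows "2 * (real CARD('n) + 1) * s k \<le> s (k + 1) + s (k - 1) + 2 * real CARD('n) / r * s k"
proof -
  have hs: "((\<lambda>j. weight r j * q k j) has_sum s k) UNIV" if "k \<le> M + 1" for k
    unfolding s_def using r q that by (intro has_sum_weight_mult[where C = C]) auto
  \<comment> \<open>Translating the sum by \<open>a e\<^sub>l\<close> moves the shift from \<open>q\<close> to the weight.\<close>
  have shift: "\<exists>S. ((\<lambda>j. weight r j * q k (j + axis l a)) has_sum S) UNIV \<and> S \<le> s k / r"
    if "\<bar>a\<bar> = 1" for l a
  proof -
    have bound: "weight r (j + axis l (- a)) * q k j \<le> weight r j * q k j * (1 / r)" for j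
      using weight_add_axis_le[OF r, of "- a" j l] that q[of k] k
      by (auto intro: mult_right_mono[THEN order_trans])
    have sk: "((\<lambda>j. weight r j * q k j * (1 / r)) has_sum s k * (1 / r)) UNIV"
      using hs k by (intro has_sum_cmult_left) auto
    then have "(\<lambda>j. weight r (j + axis l (- a)) * q k j) summable_on UNIV"
      using bound r q k
      by (intro summable_on_comparison_test[OF has_sum_imp_summable[OF sk]])
        (auto intro!: mult_nonneg_nonneg weight_nonneg)
    then obtain S where S: "((\<lambda>j. weight r (j + axis l (- a)) * q k j) has_sum S) UNIV"
      by (auto simp: summable_on_def)
    then have "S \<le> s k / r" using has_sum_mono[OF S sk] bound by simp
    moreover have "((\<lambda>j. weight r j * q k (j + axis l a)) has_sum S) UNIV"
    proof -
      have cancel: "j + axis l a + axis l (- a) = j" for j :: "int ^ 'n"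
        by (simp add: vec_eq_iff axis_def)
      show ?thesis
        using has_sum_translate[of "\<lambda>j. weight r (j + axis l (- a)) * q k j" "axis l a" S] S
        by (simp only: cancel)
    qed
    ultimately show ?thesis by blast
  qed
  obtain S1 where S1: "\<And>l. ((\<lambda>j. weight r j * q k (j + axis l 1)) has_sum S1 l) UNIV"
    "\<And>l. S1 l \<le> s k / r"
    using shift[of 1] by auto metis
  obtain S2 where S2: "\<And>l. ((\<lambda>j. weight r j * q k (j + axis l (- 1))) has_sum S2 l) UNIV"
    "\<And>l. S2 l \<le> s k / r"
    using shift[of "-1"] by auto metis
  have "((\<lambda>j. \<Sum>l\<in>UNIV. weight r j * q k (j + axis l 1) + weight r j * q k (j + axis l (- 1)))
      has_sum (\<Sum>l\<in>UNIV. S1 l + S2 l)) UNIV"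
    by (intro has_sum_finite_sum has_sum_add S1 S2) auto
  then have N: "((\<lambda>j. weight r j * nbr_sum (q k) j) has_sum (\<Sum>l\<in>UNIV. S1 l + S2 l)) UNIV"
    by (simp add: nbr_sum_def axis_minus_one sum_distrib_left distrib_left)
  have "2 * (real CARD('n) + 1) * s k \<le> s (k + 1) + s (k - 1) + (\<Sum>l\<in>UNIV. S1 l + S2 l)"
  proof (rule has_sum_mono)
    show "((\<lambda>j. 2 * (real CARD('n) + 1) * (weight r j * q k j)) has_sum
        2 * (real CARD('n) + 1) * s k) UNIV"
      using hs k by (intro has_sum_cmult_right) auto
    show "((\<lambda>j. weight r j * q (k + 1) j + weight r j * q (k - 1) j +
        weight r j * nbr_sum (q k) j) has_sum
        s (k + 1) + s (k - 1) + (\<Sum>l\<in>UNIV. S1 l + S2 l)) UNIV"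
      using hs k by (intro has_sum_add N) auto
    fix j
    have "weight r j * (2 * (real CARD('n) + 1) * q k j) \<le>
        weight r j * (q (k + 1) j + q (k - 1) j + nbr_sum (q k) j)"
      using sub[of j] r by (intro mult_left_mono weight_nonneg) auto
    then show "2 * (real CARD('n) + 1) * (weight r j * q k j) \<le>
        weight r j * q (k + 1) j + weight r j * q (k - 1) j + weight r j * nbr_sum (q k) j"
      by (simp add: algebra_simps)
  qed
  moreover have "(\<Sum>l\<in>(UNIV :: 'n set). S1 l + S2 l) \<le> real (card (UNIV :: 'n set)) * (2 * (s k / r))"
  proof (rule sum_bounded_above)
    fix l show "S1 l + S2 l \<le> 2 * (s k / r)" using S1(2)[of l] S2(2)[of l] by simp
  qed
  ultimately show ?thesis by (simp add: field_simps)
qed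

text \<open>
  A discrete convexity estimate with a small zeroth-order term: the concave function
  \<open>g k = 1 + k (M + 1 - k)\<close> has second difference \<open>- 2\<close>, so \<open>s / g\<close> has no positive interior
  maximum as long as \<open>\<kappa> g < 2\<close>.
\<close>

lemma almost_convex_bound:
  fixes s :: "nat \<Rightarrow> real"
  assumes conv: "\<And>k. k \<in> {1..M} \<Longrightarrow> (2 - \<kappa>) * s k \<le> s (k + 1) + s (k - 1)"
    and \<kappa>: "0 \<le> \<kappa>" "\<kappa> * (1 + (real M + 1)\<^sup>2) < 2"
    and D: "s 0 \<le> D" "s (M + 1) \<le> D" "0 \<le> D"
    and k: "k \<le> M + 1"
  shows "s k \<le> D * (1 + (real M + 1)\<^sup>2)"
proof -
  define g where "g k = 1 + real k * (real M + 1 - real k)" for k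
  have g_pos: "g k \<ge> 1" if "k \<le> M + 1" for k
    using that by (simp add: g_def)
  have g_le: "g k \<le> 1 + (real M + 1)\<^sup>2" if "k \<le> M + 1" for k
    unfolding g_def power2_eq_square using that by (intro add_left_mono mult_mono) auto
  define m where "m = Max ((\<lambda>k. s k / g k) ` {..M + 1})"
  have le_m: "s k \<le> m * g k" if "k \<le> M + 1" for k
  proof -
    have "s k / g k \<le> m" unfolding m_def using that by (intro Max_ge) auto
    then show ?thesis using g_pos[OF that] by (simp add: field_simps)
  qed
  have "m \<in> (\<lambda>k. s k / g k) ` {..M + 1}" unfolding m_def by (intro Max_in) auto
  then obtain i where i: "i \<le> M + 1" "m = s i / g i" by auto
  have s_i: "s i = m * g i" using i g_pos[OF i(1)] by simp
  have "m \<le> D"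
  proof (rule ccontr)
    assume "\<not> m \<le> D"
    then have "m > 0" using D by simp
    have g_end: "g 0 = 1" "g (M + 1) = 1" by (simp_all add: g_def)
    have "i \<noteq> 0" "i \<noteq> M + 1" using s_i D g_end \<open>\<not> m \<le> D\<close> by (metis mult.right_neutral)+
    then have I: "i \<in> {1..M}" using i by auto
    have "s (i + 1) \<le> m * g (i + 1)" "s (i - 1) \<le> m * g (i - 1)"
      using I by (auto intro!: le_m simp del: One_nat_def)
    then have "(2 - \<kappa>) * (m * g i) \<le> m * g (i + 1) + m * g (i - 1)"
      using conv[OF I] unfolding s_i by linarith
    also have "\<dots> = m * (2 * g i - 2)"
      using I by (simp add: g_def of_nat_diff algebra_simps)
    finally have "m * (2 - \<kappa> * g i) \<le> 0" by (simp add: algebra_simps)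
    then have "2 \<le> \<kappa> * g i" using \<open>m > 0\<close> by (simp add: mult_le_0_iff)
    also have "\<dots> \<le> \<kappa> * (1 + (real M + 1)\<^sup>2)"
      using g_le[OF i(1)] \<kappa>(1) by (rule mult_left_mono)
    finally show False using \<kappa>(2) by simp
  qed
  have "s k \<le> m * g k" using le_m[OF k] .
  also have "\<dots> \<le> D * g k" using \<open>m \<le> D\<close> g_pos[OF k] by (intro mult_right_mono) auto
  also have "\<dots> \<le> D * (1 + (real M + 1)\<^sup>2)" using g_le[OF k] D by (intro mult_left_mono) auto
  finally show ?thesis .
qed

text \<open>
  Boundedness is only needed to make the weighted sums converge; it does not enter the bound.
\<close>

lemma strip_harmonic_square_summable:
  fixes U :: "nat \<Rightarrow> int ^ 'n::finite \<Rightarrow> real"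
  assumes U: "strip_harmonic M U"
    and bounded: "\<And>k j. k \<le> M + 1 \<Longrightarrow> \<bar>U k j\<bar> \<le> C"
    and bd: "(\<lambda>j. (U 0 j)\<^sup>2) summable_on UNIV" "(\<lambda>j. (U (M + 1) j)\<^sup>2) summable_on UNIV"
    and k: "k \<le> M + 1"
  shows "(\<lambda>j. (U k j)\<^sup>2) summable_on UNIV"
proof (rule nonneg_bdd_above_summable_on)
  define D where "D = (\<Sum>\<^sub>\<infinity>j. (U 0 j)\<^sup>2) + (\<Sum>\<^sub>\<infinity>j. (U (M + 1) j)\<^sup>2)"
  define B where "B = D * (1 + (real M + 1)\<^sup>2)"
  define \<kappa> where "\<kappa> r = 2 * real CARD('n) * (1 / r - 1)" for r :: real
  have U2: "0 \<le> (U k j)\<^sup>2" "k \<le> M + 1 \<Longrightarrow> (U k j)\<^sup>2 \<le> C\<^sup>2" for k j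
    using bounded[of k j] by (auto simp: abs_le_square_iff[symmetric] abs_of_nonneg)
  have inf_nonneg: "0 \<le> (\<Sum>\<^sub>\<infinity>j. (U k j)\<^sup>2)" for k by (rule infsum_nonneg) simp
  have bound: "(\<Sum>j\<in>F. weight r j * (U k j)\<^sup>2) \<le> B"
    if r: "0 < r" "r < 1" "\<kappa> r * (1 + (real M + 1)\<^sup>2) < 2" and F: "finite F" for r F
  proof -
    define s where "s k = (\<Sum>\<^sub>\<infinity>j. weight r j * (U k j)\<^sup>2)" for k
    have hs: "((\<lambda>j. weight r j * (U k j)\<^sup>2) has_sum s k) UNIV" if "k \<le> M + 1" for k
      unfolding s_def using r U2 that by (intro has_sum_weight_mult[where C = "C\<^sup>2"]) auto
    have s_le: "s k \<le> (\<Sum>\<^sub>\<infinity>j. (U k j)\<^sup>2)"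
      if "k \<le> M + 1" "(\<lambda>j. (U k j)\<^sup>2) summable_on UNIV" for k
    proof (rule has_sum_mono[OF hs[OF that(1)] has_sum_infsum[OF that(2)]])
      fix j show "weight r j * (U k j)\<^sup>2 \<le> (U k j)\<^sup>2"
        using weight_le_1[of r j] weight_nonneg[of r j] r
        by (intro mult_left_le_one_le) auto
    qed
    have "s k \<le> D * (1 + (real M + 1)\<^sup>2)"
    proof (rule almost_convex_bound[OF _ _ r(3) _ _ _ k])
      fix k assume K: "k \<in> {1..M}"
      have "2 * (real CARD('n) + 1) * s k \<le> s (k + 1) + s (k - 1) + 2 * real CARD('n) / r * s k"
        unfolding s_def
        by (rule weighted_sum_subharmonic[OF r(1,2) U2
              strip_harmonic_square_subharmonic[OF U K] K])
      then show "(2 - \<kappa> r) * s k \<le> s (k + 1) + s (k - 1)"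
        by (simp add: \<kappa>_def algebra_simps)
    next
      show "s 0 \<le> D" "s (M + 1) \<le> D" "0 \<le> D"
        using s_le[OF _ bd(1)] s_le[OF _ bd(2)] inf_nonneg[of 0] inf_nonneg[of "M + 1"]
        unfolding D_def by simp_all
    qed (use r in \<open>simp add: \<kappa>_def field_simps\<close>)
    moreover have "(\<Sum>j\<in>F. weight r j * (U k j)\<^sup>2) \<le> s k"
      unfolding s_def using F r hs[OF k]
      by (intro finite_sum_le_infsum)
        (auto intro!: mult_nonneg_nonneg weight_nonneg simp: has_sum_imp_summable)
    ultimately show ?thesis unfolding B_def by linarith
  qed
  \<comment> \<open>The bound is uniform in \<open>r\<close>, so the weight can be removed by letting \<open>r\<close> tend to \<open>1\<close>.\<close>
  have ev: "\<forall>\<^sub>F r in at_left 1. 0 < r \<and> r < 1 \<and> \<kappa> r * (1 + (real M + 1)\<^sup>2) < 2"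
  proof (intro eventually_conj)
    show "\<forall>\<^sub>F r :: real in at_left 1. 0 < r"
      by (rule eventually_at_leftI[of 0]) simp_all
    show "\<forall>\<^sub>F r :: real in at_left 1. r < 1"
      by (rule eventually_at_leftI[of 0]) simp_all
    have "((\<lambda>r. \<kappa> r * (1 + (real M + 1)\<^sup>2)) \<longlongrightarrow>
        2 * real CARD('n) * (1 / 1 - 1) * (1 + (real M + 1)\<^sup>2)) (at_left 1)"
      unfolding \<kappa>_def by (intro tendsto_intros) auto
    then show "\<forall>\<^sub>F r in at_left 1. \<kappa> r * (1 + (real M + 1)\<^sup>2) < 2"
      by (rule order_tendstoD) simp
  qed
  have "(\<Sum>j\<in>F. (U k j)\<^sup>2) \<le> B" if "finite F" for F
  proof (rule tendsto_upperbound)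
    have "((\<lambda>r. \<Sum>j\<in>F. weight r j * (U k j)\<^sup>2) \<longlongrightarrow>
        (\<Sum>j\<in>F. (\<Prod>i\<in>(UNIV :: 'n set). 1 ^ nat \<bar>j $ i\<bar>) * (U k j)\<^sup>2)) (at_left 1)"
      unfolding weight_def by (intro tendsto_intros)
    then show "((\<lambda>r. \<Sum>j\<in>F. weight r j * (U k j)\<^sup>2) \<longlongrightarrow> (\<Sum>j\<in>F. (U k j)\<^sup>2)) (at_left 1)"
      by simp
    show "\<forall>\<^sub>F r in at_left 1. (\<Sum>j\<in>F. weight r j * (U k j)\<^sup>2) \<le> B"
      using ev by eventually_elim (use bound that in blast)
  qed simp
  then show "bdd_above (sum (\<lambda>j. (U k j)\<^sup>2) ` {F. F \<subseteq> UNIV \<and> finite F})"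
    by (intro bdd_aboveI2[where M = B]) auto
qed simp

section \<open>The energy form on square summable functions\<close>

text \<open>Membership in \<open>\<ell>\<^sup>2\<close>, for real functions on an arbitrary index type.\<close>

definition sq_summable :: "('a \<Rightarrow> real) \<Rightarrow> bool" where
  "sq_summable f \<longleftrightarrow> (\<lambda>j. (f j)\<^sup>2) summable_on UNIV"

text \<open>The \<open>\<ell>\<^sup>2\<close> inner product; it is meaningful for square summable arguments.\<close>

definition ip :: "('a \<Rightarrow> real) \<Rightarrow> ('a \<Rightarrow> real) \<Rightarrow> real" where
  "ip f g = (\<Sum>\<^sub>\<infinity>j. f j * g j)"

lemma ip_has_sum:
  assumes "sq_summable f" "sq_summable g"
  shows "((\<lambda>j. f j * g j) has_sum ip f g) UNIV"
proof -
  have "(\<lambda>j. norm (f j * g j)) summable_on UNIV"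
  proof (rule Infinite_Sum.abs_summable_on_comparison_test')
    show "(\<lambda>j. (f j)\<^sup>2 + (g j)\<^sup>2) summable_on UNIV"
      using assms unfolding sq_summable_def by (rule summable_on_add)
    fix j
    have "0 \<le> (\<bar>f j\<bar> - \<bar>g j\<bar>)\<^sup>2" by simp
    then have "2 * (\<bar>f j\<bar> * \<bar>g j\<bar>) \<le> (f j)\<^sup>2 + (g j)\<^sup>2"
      by (simp add: power2_diff)
    moreover have "0 \<le> \<bar>f j\<bar> * \<bar>g j\<bar>" by simp
    ultimately show "norm (f j * g j) \<le> (f j)\<^sup>2 + (g j)\<^sup>2"
      unfolding real_norm_def abs_mult by linarith
  qed
  then have "(\<lambda>j. f j * g j) summable_on UNIV" by (rule abs_summable_summable)
  then show ?thesis unfolding ip_def by simp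
qed

lemma sq_summable_scale:
  assumes "sq_summable f"
  shows "sq_summable (\<lambda>j. c * f j)"
  using summable_on_cmult_right[of "\<lambda>j. (f j)\<^sup>2" UNIV "c\<^sup>2"] assms
  by (simp add: sq_summable_def power_mult_distrib)

lemma sq_summable_add:
  assumes "sq_summable f" "sq_summable g"
  shows "sq_summable (\<lambda>j. f j + g j)"
proof -
  have "(\<lambda>j. (f j)\<^sup>2 + (g j)\<^sup>2 + 2 * (f j * g j)) summable_on UNIV"
    using assms ip_has_sum[OF assms]
    by (intro summable_on_add summable_on_cmult_right) (auto simp: sq_summable_def summable_on_def)
  then show ?thesis by (simp add: sq_summable_def power2_sum mult.assoc)
qed

lemma sq_summable_diff:
  assumes "sq_summable f" "sq_summable g"
  shows "sq_summable (\<lambda>j. f j - g j)"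
  using sq_summable_add[OF assms(1) sq_summable_scale[OF assms(2), of "-1"]] by simp

lemma sq_summable_sum:
  assumes "finite I" "\<And>i. i \<in> I \<Longrightarrow> sq_summable (f i)"
  shows "sq_summable (\<lambda>j. \<Sum>i\<in>I. f i j)"
  using assms
proof (induction I rule: finite_induct)
  case empty
  show ?case by (simp add: sq_summable_def)
qed (simp add: sq_summable_add)

lemma sq_summable_translate:
  fixes f :: "'a::ab_group_add \<Rightarrow> real"
  assumes "sq_summable f"
  shows "sq_summable (\<lambda>j. f (j + a))"
  using assms has_sum_translate[of "\<lambda>j. (f j)\<^sup>2" a] by (simp add: sq_summable_def summable_on_def)

lemma ip_commute: "ip f g = ip g f"
  by (simp add: ip_def mult.commute)

lemma ip_self_nonneg: "0 \<le> ip f f"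
  unfolding ip_def by (rule infsum_nonneg) simp

lemma ip_add_left:
  assumes "sq_summable f" "sq_summable g" "sq_summable h"
  shows "ip (\<lambda>j. f j + g j) h = ip f h + ip g h"
  using has_sum_add[OF ip_has_sum[OF assms(1,3)] ip_has_sum[OF assms(2,3)]]
  by (simp add: ip_def distrib_right infsumI)

lemma ip_diff_left:
  assumes "sq_summable f" "sq_summable g" "sq_summable h"
  shows "ip (\<lambda>j. f j - g j) h = ip f h - ip g h"
  using ip_add_left[of "\<lambda>j. f j - g j" g h] assms by (simp add: sq_summable_diff)

lemma ip_add_right:
  assumes "sq_summable f" "sq_summable g" "sq_summable h"
  shows "ip h (\<lambda>j. f j + g j) = ip h f + ip h g"
  using ip_add_left[OF assms] by (simp add: ip_commute)

lemma ip_diff_right: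
  assumes "sq_summable f" "sq_summable g" "sq_summable h"
  shows "ip h (\<lambda>j. f j - g j) = ip h f - ip h g"
  using ip_diff_left[OF assms] by (simp add: ip_commute)

lemma ip_scale_right: "ip f (\<lambda>j. c * g j) = c * ip f g"
  unfolding ip_def by (simp add: mult.left_commute infsum_cmult_right')

lemma ip_scale_left: "ip (\<lambda>j. c * f j) g = c * ip f g"
  by (metis ip_commute ip_scale_right)

lemma ip_translate:
  fixes f g :: "'a::ab_group_add \<Rightarrow> real"
  shows "ip (\<lambda>j. f (j + a)) g = ip f (\<lambda>j. g (j - a))"
  unfolding ip_def
  by (rule infsum_reindex_bij_witness[where i = "\<lambda>j. j - a" and j = "\<lambda>j. j + a"]) auto

text \<open>Cauchy--Schwarz for finite families of square summable functions.\<close>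

lemma sum_ip_Cauchy_Schwarz:
  assumes f: "\<And>i. i \<in> I \<Longrightarrow> sq_summable (f i)" and g: "\<And>i. i \<in> I \<Longrightarrow> sq_summable (g i)"
  shows "(\<Sum>i\<in>I. ip (f i) (g i))\<^sup>2 \<le> (\<Sum>i\<in>I. ip (f i) (f i)) * (\<Sum>i\<in>I. ip (g i) (g i))"
proof -
  define P Q R where "P = (\<Sum>i\<in>I. ip (f i) (f i))" and "Q = (\<Sum>i\<in>I. ip (g i) (g i))"
    and "R = (\<Sum>i\<in>I. ip (f i) (g i))"
  have quad: "0 \<le> P - 2 * t * R + t\<^sup>2 * Q" for t
  proof -
    have "ip (\<lambda>j. f i j - t * g i j) (\<lambda>j. f i j - t * g i j) =
        ip (f i) (f i) - 2 * t * ip (f i) (g i) + t\<^sup>2 * ip (g i) (g i)" if "i \<in> I" for i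
    proof -
      note [simp] = f[OF that] g[OF that] sq_summable_scale sq_summable_diff
      show ?thesis
        by (simp add: ip_diff_left ip_diff_right ip_scale_left ip_scale_right
            ip_commute[of "g i" "f i"] power2_eq_square algebra_simps)
    qed
    then have "P - 2 * t * R + t\<^sup>2 * Q =
        (\<Sum>i\<in>I. ip (\<lambda>j. f i j - t * g i j) (\<lambda>j. f i j - t * g i j))"
      by (simp add: P_def Q_def R_def sum.distrib sum_subtractf sum_distrib_left)
    also have "\<dots> \<ge> 0" by (intro sum_nonneg ip_self_nonneg)
    finally show ?thesis .
  qed
  have "Q \<ge> 0" unfolding Q_def by (intro sum_nonneg ip_self_nonneg)
  show ?thesis unfolding P_def[symmetric] Q_def[symmetric] R_def[symmetric]
  proof (cases "Q = 0")
    case True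
    have "R = 0"
    proof (rule ccontr)
      assume "R \<noteq> 0"
      then show False using quad[of "(P + 1) / (2 * R)"] True by (simp add: field_simps)
    qed
    then show "R\<^sup>2 \<le> P * Q" using True by simp
  next
    case False
    then have "Q > 0" using \<open>Q \<ge> 0\<close> by simp
    then show "R\<^sup>2 \<le> P * Q"
      using quad[of "R / Q"] by (simp add: field_simps power2_eq_square)
  qed
qed

text \<open>The nonnegative discrete Laplacian of the lattice \<open>\<int>\<^sup>n\<close>.\<close>

definition lattice_lap :: "(int ^ 'n::finite \<Rightarrow> real) \<Rightarrow> int ^ 'n \<Rightarrow> real" where
  "lattice_lap f j = 2 * real CARD('n) * f j - nbr_sum f j"

lemma lattice_lap_eq_sum:
  "lattice_lap f j = (\<Sum>l\<in>UNIV. 2 * f j - f (j + axis l 1) - f (j - axis l 1))"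
  by (simp add: lattice_lap_def nbr_sum_def sum_subtractf sum.distrib)

lemma sq_summable_lattice_lap:
  assumes "sq_summable f"
  shows "sq_summable (lattice_lap f)"
proof -
  have "sq_summable (\<lambda>j. \<Sum>l\<in>UNIV. 2 * f j - f (j + axis l 1) - f (j + axis l (- 1)))"
    using assms
    by (intro sq_summable_sum sq_summable_diff sq_summable_translate sq_summable_scale) auto
  then show ?thesis by (simp add: lattice_lap_eq_sum[abs_def] axis_minus_one)
qed

text \<open>Summation by parts.\<close>

lemma sum_ip_gradient:
  fixes f g :: "int ^ 'n::finite \<Rightarrow> real"
  assumes f: "sq_summable f" and g: "sq_summable g"
  shows "(\<Sum>l\<in>UNIV. ip (\<lambda>j. f (j + axis l 1) - f j) (\<lambda>j. g (j + axis l 1) - g j)) =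
    ip (lattice_lap f) g"
proof -
  have sm: "sq_summable (\<lambda>j. f (j - axis l 1))" for l
    using sq_summable_translate[OF f, of "axis l (- 1)"] by (simp add: axis_minus_one)
  note [simp] = f g sm sq_summable_translate sq_summable_diff sq_summable_scale
  have 1: "ip (\<lambda>j. f (j + axis l 1) - f j) (\<lambda>j. g (j + axis l 1) - g j) =
      ip (\<lambda>j. 2 * f j - f (j + axis l 1) - f (j - axis l 1)) g" for l
  proof -
    have "ip f (\<lambda>j. g (j + axis l 1)) = ip (\<lambda>j. f (j - axis l 1)) g"
      using ip_translate[of g "axis l 1" f] by (simp add: ip_commute)
    moreover have "ip (\<lambda>j. f (j + axis l 1)) (\<lambda>j. g (j + axis l 1)) = ip f g"
      using ip_translate[of f "axis l 1" "\<lambda>j. g (j + axis l 1)"] by simp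
    ultimately show ?thesis
      by (simp add: ip_diff_left ip_diff_right ip_scale_left)
  qed
  have "((\<lambda>j. \<Sum>l\<in>UNIV. (2 * f j - f (j + axis l 1) - f (j - axis l 1)) * g j) has_sum
      (\<Sum>l\<in>UNIV. ip (\<lambda>j. 2 * f j - f (j + axis l 1) - f (j - axis l 1)) g)) UNIV"
    by (intro has_sum_finite_sum ip_has_sum) auto
  then have "ip (lattice_lap f) g =
      (\<Sum>l\<in>UNIV. ip (\<lambda>j. 2 * f j - f (j + axis l 1) - f (j - axis l 1)) g)"
    by (simp add: ip_def lattice_lap_eq_sum sum_distrib_right[symmetric] infsumI)
  then show ?thesis by (simp add: 1)
qed

lemma ip_lattice_lap_commute:
  fixes f g :: "int ^ 'n::finite \<Rightarrow> real"
  assumes "sq_summable f" "sq_summable g"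
  shows "ip (lattice_lap f) g = ip f (lattice_lap g)"
proof -
  have "ip (lattice_lap f) g = ip (lattice_lap g) f"
    unfolding sum_ip_gradient[OF assms, symmetric] sum_ip_gradient[OF assms(2,1), symmetric]
    by (simp add: ip_commute)
  then show ?thesis by (simp add: ip_commute)
qed

text \<open>
  The components of the discrete gradient on layer \<open>k\<close>: the index \<open>None\<close> is the forward
  difference in \<open>x\<close>, the index \<open>Some l\<close> the one in \<open>y\<^sub>l\<close>.
\<close>

definition grad :: "(nat \<Rightarrow> int ^ 'n::finite \<Rightarrow> real) \<Rightarrow> nat \<Rightarrow> 'n option \<Rightarrow> int ^ 'n \<Rightarrow> real" where
  "grad U k i j = (case i of None \<Rightarrow> U (k + 1) j - U k j | Some l \<Rightarrow> U k (j + axis l 1) - U k j)"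

text \<open>
  The \<open>\<ell>\<^sup>2\<close> inner product of the gradients on the layers \<open>k\<close> and \<open>l\<close>; on the diagonal it is the
  energy of a layer.
\<close>

definition energy_form :: "(nat \<Rightarrow> int ^ 'n::finite \<Rightarrow> real) \<Rightarrow> nat \<Rightarrow> nat \<Rightarrow> real" where
  "energy_form U k l = (\<Sum>i\<in>UNIV. ip (grad U k i) (grad U l i))"

lemma sum_UNIV_option: "(\<Sum>i\<in>UNIV. f i) = f None + (\<Sum>l\<in>UNIV. f (Some l))"
  for f :: "'n::finite option \<Rightarrow> real"
  by (simp add: UNIV_option_conv sum.reindex)

lemma sq_summable_grad:
  assumes "\<And>k. k \<le> M + 1 \<Longrightarrow> sq_summable (U k)" "k \<le> M"
  shows "sq_summable (grad U k i)"
  using assms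
  by (cases i) (auto simp: grad_def[abs_def] intro!: sq_summable_diff sq_summable_translate)

lemma energy_form_eq:
  assumes "\<And>k. k \<le> M + 1 \<Longrightarrow> sq_summable (U k)" "k \<le> M" "l \<le> M"
  shows "energy_form U k l =
    ip (\<lambda>j. U (k + 1) j - U k j) (\<lambda>j. U (l + 1) j - U l j) + ip (lattice_lap (U k)) (U l)"
  using assms
  by (simp add: energy_form_def sum_UNIV_option grad_def[abs_def] sum_ip_gradient)

text \<open>
  For a harmonic \<open>U\<close> the form depends only on the sum of the two layers. On the Fourier side
  \<open>U k\<close> is \<open>A e\<^bsup>k \<theta>\<^esup> + B e\<^bsup>- k \<theta>\<^esup>\<close>, where \<open>2 cosh \<theta> - 2\<close> is the symbol of the lattice
  Laplacian, and the mixed terms in \<open>A B\<close> of the energy form cancel.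
\<close>

lemma energy_form_shift:
  fixes U :: "nat \<Rightarrow> int ^ 'n::finite \<Rightarrow> real"
  assumes U: "strip_harmonic M U"
    and sq: "\<And>k. k \<le> M + 1 \<Longrightarrow> sq_summable (U k)"
    and k: "1 \<le> k" "k < M"
  shows "energy_form U (k - 1) (k + 1) = energy_form U k k"
proof -
  define a b c d where abcd: "a = U (k - 1)" "b = U k" "c = U (k + 1)" "d = U (k + 2)"
  have rec: "b j - a j = (c j - b j) - lattice_lap b j" "d j - c j = (c j - b j) + lattice_lap c j"
    for j
    using U k unfolding strip_harmonic_def abcd lattice_lap_def
    by (auto dest!: bspec[where x = k] bspec[where x = "k + 1"] spec[where x = j]
        simp: algebra_simps)
  have "sq_summable a" "sq_summable b" "sq_summable c" "sq_summable d"
    using sq k by (auto simp: abcd)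
  note [simp] = this sq_summable_lattice_lap sq_summable_diff sq_summable_add
  have "energy_form U (k - 1) (k + 1) =
      ip (\<lambda>j. b j - a j) (\<lambda>j. d j - c j) + ip (lattice_lap a) c"
    using energy_form_eq[where k = "k - 1" and l = "k + 1", OF sq] k by (simp add: abcd)
  also have "ip (\<lambda>j. b j - a j) (\<lambda>j. d j - c j) =
      ip (\<lambda>j. b j - a j) (\<lambda>j. c j - b j) + ip b (lattice_lap c) - ip a (lattice_lap c)"
    unfolding rec(2) by (subst ip_add_right) (simp_all add: ip_diff_left)
  also have "ip (\<lambda>j. b j - a j) (\<lambda>j. c j - b j) =
      ip (\<lambda>j. c j - b j) (\<lambda>j. c j - b j) - ip (lattice_lap b) c + ip (lattice_lap b) b"
    unfolding rec(1) by (subst ip_diff_left) (simp_all add: ip_diff_right)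
  also have "ip a (lattice_lap c) = ip (lattice_lap a) c" by (simp add: ip_lattice_lap_commute)
  also have "ip b (lattice_lap c) = ip (lattice_lap b) c" by (simp add: ip_lattice_lap_commute)
  also have "ip (\<lambda>j. c j - b j) (\<lambda>j. c j - b j) - ip (lattice_lap b) c + ip (lattice_lap b) b
      + ip (lattice_lap b) c - ip (lattice_lap a) c + ip (lattice_lap a) c = energy_form U k k"
    using energy_form_eq[where k = k and l = k, OF sq] k by (simp add: abcd)
  finally show ?thesis .
qed

text \<open>Cauchy--Schwarz for the energy form applied to the layers \<open>k - 1\<close> and \<open>k + 1\<close>.\<close>

lemma energy_form_log_convex:
  fixes U :: "nat \<Rightarrow> int ^ 'n::finite \<Rightarrow> real"
  assumes U: "strip_harmonic M U"
    and sq: "\<And>k. k \<le> M + 1 \<Longrightarrow> sq_summable (U k)"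
    and k: "1 \<le> k" "k < M"
  shows "(energy_form U k k)\<^sup>2 \<le>
    energy_form U (k - 1) (k - 1) * energy_form U (k + 1) (k + 1)"
proof -
  have "(energy_form U (k - 1) (k + 1))\<^sup>2 \<le>
      energy_form U (k - 1) (k - 1) * energy_form U (k + 1) (k + 1)"
    unfolding energy_form_def
    using k by (intro sum_ip_Cauchy_Schwarz sq_summable_grad[OF sq]) auto
  then show ?thesis by (simp only: energy_form_shift[OF U sq k])
qed

lemma diff_x_eq_grad:
  "diff_x \<delta> u (\<delta> * real k) (grid \<delta> j) = grad (\<lambda>k j. u (\<delta> * real k, grid \<delta> j)) k None j / \<delta>"
  by (simp add: diff_x_def grad_def algebra_simps)

lemma diff_y_eq_grad:
  "diff_y \<delta> u l (\<delta> * real k) (grid \<delta> j) =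
    grad (\<lambda>k j. u (\<delta> * real k, grid \<delta> j)) k (Some l) j / \<delta>"
  by (simp add: diff_y_def grad_def grid_add_axis)

lemma slice_energy_eq:
  fixes u :: "real \<times> (real ^ 'n::finite) \<Rightarrow> real"
  assumes "\<delta> \<noteq> 0"
  shows "slice_energy \<delta> u k = energy_form (\<lambda>k j. u (\<delta> * real k, grid \<delta> j)) k k"
proof -
  have "\<delta>\<^sup>2 * (\<Sum>\<^sub>\<infinity>j. \<bar>f j / \<delta>\<bar>\<^sup>2) = ip f f" for f :: "int ^ 'n \<Rightarrow> real"
    using assms
    by (simp add: ip_def power2_eq_square infsum_cmult_right'[symmetric])
  then show ?thesis
    by (simp only: slice_energy_def energy_form_def sum_UNIV_option sum_distrib_left
        diff_x_eq_grad diff_y_eq_grad)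
qed

lemma finite_slice_energyI:
  fixes u :: "real \<times> (real ^ 'n::finite) \<Rightarrow> real"
  assumes "\<And>i. sq_summable (grad (\<lambda>k j. u (\<delta> * real k, grid \<delta> j)) k i)"
  shows "finite_slice_energy \<delta> u k"
  using sq_summable_scale[OF assms, of "1 / \<delta>"]
  by (simp add: finite_slice_energy_def sq_summable_def diff_x_eq_grad diff_y_eq_grad
      del: abs_divide)

section \<open>Log-convex sequences\<close>

text \<open>
  The quotient of \<open>m\<close> by the exponential sequence is again log-convex and satisfies the maximum
  principle. Working with quotients instead of logarithms allows \<open>m\<close> to vanish.
\<close>

lemma log_convex_le_exp:
  fixes m :: "nat \<Rightarrow> real"
  assumes nonneg: "\<And>k. 0 \<le> m k"
    and conv: "\<And>k. 1 \<le> k \<Longrightarrow> k < M \<Longrightarrow> (m k)\<^sup>2 \<le> m (k - 1) * m (k + 1)"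
    and ends: "m 0 \<le> exp \<alpha>" "m M \<le> exp (\<alpha> + \<beta> * real M)"
    and "k \<le> M"
  shows "m k \<le> exp (\<alpha> + \<beta> * real k)"
proof (rule ccontr)
  assume big: "\<not> m k \<le> exp (\<alpha> + \<beta> * real k)"
  define p where "p k = m k / exp (\<alpha> + \<beta> * real k)" for k
  define P where "P = Max (p ` {..M})"
  have p_le: "p k \<le> P" if "k \<le> M" for k unfolding P_def using that by (intro Max_ge) auto
  have "p k > 1" using big by (simp add: p_def)
  then have "P > 1" using p_le[OF \<open>k \<le> M\<close>] by simp
  have p_nonneg: "0 \<le> p k" for k using nonneg by (simp add: p_def)
  have p_ends: "p 0 \<le> 1" "p M \<le> 1" using ends by (simp_all add: p_def)
  have p_conv: "(p k)\<^sup>2 \<le> p (k - 1) * p (k + 1)" if "1 \<le> k" "k < M" for k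
  proof -
    have "exp (\<alpha> + \<beta> * real (k - 1)) * exp (\<alpha> + \<beta> * real (k + 1)) = (exp (\<alpha> + \<beta> * real k))\<^sup>2"
      using that by (simp add: exp_add[symmetric] power2_eq_square of_nat_diff algebra_simps)
    then show ?thesis
      using conv[OF that] by (simp add: p_def power_divide divide_right_mono)
  qed
  \<comment> \<open>The last maximum point of \<open>p\<close> is interior, and so is followed by another one.\<close>
  define T where "T = {k. k \<le> M \<and> p k = P}"
  have "P \<in> p ` {..M}" unfolding P_def by (intro Max_in) auto
  then have T: "finite T" "T \<noteq> {}" by (auto simp: T_def)
  define K where "K = Max T"
  have "K \<in> T" unfolding K_def using T by (rule Max_in)
  then have K: "K \<le> M" "p K = P" by (auto simp: T_def)
  have "K \<noteq> 0" "K \<noteq> M" using K p_ends \<open>P > 1\<close> by (metis not_le)+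
  then have I: "1 \<le> K" "K < M" using K by auto
  have "P * P \<le> p (K - 1) * p (K + 1)" using p_conv[OF I] K by (simp add: power2_eq_square)
  also have "\<dots> \<le> P * p (K + 1)" using I p_le p_nonneg by (intro mult_right_mono) auto
  finally have "P \<le> p (K + 1)" using \<open>P > 1\<close> by simp
  then have "K + 1 \<in> T" using p_le[of "K + 1"] I by (auto simp: T_def)
  then have "K + 1 \<le> K" unfolding K_def using T(1) by (rule Max_ge[rotated])
  then show False by simp
qed

lemma log_convex_interpolation:
  fixes m :: "nat \<Rightarrow> real"
  assumes nonneg: "\<And>k. 0 \<le> m k"
    and conv: "\<And>k. 1 \<le> k \<Longrightarrow> k < M \<Longrightarrow> (m k)\<^sup>2 \<le> m (k - 1) * m (k + 1)"
    and "1 \<le> M" and k: "k \<le> M"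
  shows "m k \<le> rpow (m 0) (1 - real k / real M) * rpow (m M) (real k / real M)"
proof -
  consider "k = 0" | "k = M" | "0 < k" "k < M" using k by linarith
  then show ?thesis
  proof cases
    case 3
    define t where "t = real k / real M"
    have t: "0 < t" "t < 1" using 3 by (auto simp: t_def)
    \<comment> \<open>The end values may vanish, so they are first increased by \<open>\<epsilon>\<close>.\<close>
    have le: "m k \<le> (m 0 + \<epsilon>) powr (1 - t) * (m M + \<epsilon>) powr t" if "\<epsilon> > 0" for \<epsilon>
    proof -
      define A B where "A = m 0 + \<epsilon>" and "B = m M + \<epsilon>"
      have AB: "A > 0" "B > 0" using that nonneg[of 0] nonneg[of M] by (auto simp: A_def B_def)
      define \<beta> where "\<beta> = (ln B - ln A) / real M"
      have \<beta>: "\<beta> * real M = ln B - ln A" "\<beta> * real k = (ln B - ln A) * t"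
        using \<open>1 \<le> M\<close> by (simp_all add: \<beta>_def t_def)
      have "m k \<le> exp (ln A + \<beta> * real k)"
      proof (rule log_convex_le_exp[where M = M and m = m])
        show "m 0 \<le> exp (ln A)" "m M \<le> exp (ln A + \<beta> * real M)"
          using AB that by (simp_all add: \<beta>(1)) (simp_all add: A_def B_def)
      qed (use nonneg conv k in auto)
      also have "\<dots> = A powr (1 - t) * B powr t"
        using AB by (simp add: \<beta>(2) powr_def exp_add[symmetric] algebra_simps)
      finally show ?thesis unfolding A_def B_def .
    qed
    have lim: "m k \<le> m 0 powr (1 - t) * m M powr t"
    proof (rule tendsto_lowerbound)
      have "((\<lambda>\<epsilon>. (m 0 + \<epsilon>) powr (1 - t) * (m M + \<epsilon>) powr t) \<longlongrightarrow>
          (m 0 + 0) powr (1 - t) * (m M + 0) powr t) (at_right 0)"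
        using t nonneg
        by (intro tendsto_intros disjI2 conjI eventually_at_rightI[of 0 1]) auto
      then show "((\<lambda>\<epsilon>. (m 0 + \<epsilon>) powr (1 - t) * (m M + \<epsilon>) powr t) \<longlongrightarrow>
          m 0 powr (1 - t) * m M powr t) (at_right 0)"
        by simp
      show "\<forall>\<^sub>F \<epsilon> in at_right 0. m k \<le> (m 0 + \<epsilon>) powr (1 - t) * (m M + \<epsilon>) powr t"
        using le by (intro eventually_at_rightI[of 0 1]) auto
    qed simp
    show ?thesis unfolding rpow_def t_def[symmetric] using t lim by simp
  qed (use \<open>1 \<le> M\<close> nonneg in \<open>auto simp: rpow_def\<close>)
qed

section \<open>Log-convexity of the gradient energy\<close>

theorem theorem3:
  fixes u :: "real \<times> (real ^ 'n::finite) \<Rightarrow> real"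
    and M :: nat and \<delta> b :: real
  assumes "M \<ge> 1"
    and "\<delta> > 0" and "1 / \<delta> = real M + 1"
    and harmonic: "\<And>k (j :: int ^ 'n). k \<in> {1..M} \<Longrightarrow>
           discrete_laplacian \<delta> u (\<delta> * real k, grid \<delta> j) = 0"
    and "b > 0"
    and "cosh (\<delta> * b) =
           (real CARD('n) + 1) / real CARD('n) - 1 / real CARD('n) * cos (pi * \<delta>)"
    and growth: "\<And>\<epsilon>. \<epsilon> > 0 \<Longrightarrow> \<exists>R>0. \<forall>k\<le>M + 1. \<forall>j :: int ^ 'n.
           norm1 (grid \<delta> j) \<ge> R \<longrightarrow>
             \<bar>u (\<delta> * real k, grid \<delta> j)\<bar> \<le> \<epsilon> * exp (b * norm1 (grid \<delta> j))"
    and "(\<lambda>j :: int ^ 'n. \<bar>u (0, grid \<delta> j)\<bar>\<^sup>2) summable_on UNIV"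
    and "(\<lambda>j :: int ^ 'n. \<bar>u (1, grid \<delta> j)\<bar>\<^sup>2) summable_on UNIV"
  shows "(\<forall>k\<le>M. finite_slice_energy \<delta> u k) \<and>
         (\<forall>k\<le>M. slice_energy \<delta> u k \<le>
            rpow (slice_energy \<delta> u 0) (1 - real k / real M) *
            rpow (slice_energy \<delta> u M) (real k / real M))"
proof -
  define U where "U = (\<lambda>k j. u (\<delta> * real k, grid \<delta> (j :: int ^ 'n)))"
  have \<delta>: "\<delta> > 0" "\<delta> \<noteq> 0" using \<open>\<delta> > 0\<close> by auto
  have \<delta>M: "\<delta> * real (M + 1) = 1" using \<open>1 / \<delta> = real M + 1\<close> \<delta> by (simp add: field_simps)
  have U0: "U 0 j = u (0, grid \<delta> j)" for j by (simp add: U_def)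
  have U1: "U (M + 1) j = u (1, grid \<delta> j)" for j unfolding U_def \<delta>M ..
  have U: "strip_harmonic M U"
    unfolding U_def using \<delta>(1) harmonic by (rule discrete_laplacian_zero_imp_strip_harmonic)
  have bd: "(\<lambda>j. (U 0 j)\<^sup>2) summable_on UNIV" "(\<lambda>j. (U (M + 1) j)\<^sup>2) summable_on UNIV"
    unfolding U0 U1 using assms(8,9) by (simp_all only: power2_abs)
  \<comment> \<open>The summand \<open>1\<close> allows \<open>|x| \<le> 1 + x\<^sup>2\<close> to be used instead of a square root.\<close>
  define C where "C = 1 + (\<Sum>\<^sub>\<infinity>j. (U 0 j)\<^sup>2) + (\<Sum>\<^sub>\<infinity>j. (U (M + 1) j)\<^sup>2)"
  have bd_le: "\<bar>U 0 j\<bar> \<le> C" "\<bar>U (M + 1) j\<bar> \<le> C" for j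
  proof -
    have sq: "\<bar>x\<bar> \<le> 1 + x\<^sup>2" for x :: real
      using zero_le_power2[of "\<bar>x\<bar> - 1"] by (simp add: power2_diff)
    have "(U 0 j)\<^sup>2 \<le> (\<Sum>\<^sub>\<infinity>j. (U 0 j)\<^sup>2)" "(U (M + 1) j)\<^sup>2 \<le> (\<Sum>\<^sub>\<infinity>j. (U (M + 1) j)\<^sup>2)"
      using finite_sum_le_infsum[OF bd(1), of "{j}"] finite_sum_le_infsum[OF bd(2), of "{j}"]
      by simp_all
    moreover have "0 \<le> (\<Sum>\<^sub>\<infinity>j. (U k j)\<^sup>2)" for k by (rule infsum_nonneg) simp
    note this[of 0] this[of "M + 1"]
    ultimately show "\<bar>U 0 j\<bar> \<le> C" "\<bar>U (M + 1) j\<bar> \<le> C"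
      using sq[of "U 0 j"] sq[of "U (M + 1) j"] unfolding C_def by linarith+
  qed
  have bounded: "\<bar>U k j\<bar> \<le> C" if "k \<le> M + 1" for k j
    by (rule strip_harmonic_bounded[OF \<delta>(1) assms(3) \<open>b > 0\<close> U assms(6) _ bd_le that])
      (unfold U_def, rule growth)
  have sq: "sq_summable (U k)" if "k \<le> M + 1" for k
    unfolding sq_summable_def using U bounded bd that by (rule strip_harmonic_square_summable)
  have energy: "slice_energy \<delta> u k = energy_form U k k" for k
    unfolding U_def using \<delta>(2) by (rule slice_energy_eq)
  have "finite_slice_energy \<delta> u k" if "k \<le> M" for k
    using sq_summable_grad[OF sq that] unfolding U_def by (rule finite_slice_energyI)
  moreover have "slice_energy \<delta> u k \<le> rpow (slice_energy \<delta> u 0) (1 - real k / real M) *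
      rpow (slice_energy \<delta> u M) (real k / real M)" if "k \<le> M" for k
    unfolding energy
  proof (rule log_convex_interpolation[where m = "\<lambda>k. energy_form U k k"])
    show "0 \<le> energy_form U k k" for k
      unfolding energy_form_def by (intro sum_nonneg ip_self_nonneg)
    show "(energy_form U k k)\<^sup>2 \<le> energy_form U (k - 1) (k - 1) * energy_form U (k + 1) (k + 1)"
      if "1 \<le> k" "k < M" for k
      using U sq that by (rule energy_form_log_convex)
  qed (use \<open>M \<ge> 1\<close> that in auto)
  ultimately show ?thesis by blast
qed

end
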